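(* Let $k>0$ be an integer, let $f:\mathbb{R}\to\mathbb{R}$ be an analytic function, and let $\mathsf{f}^{(k+1)}$ be a formula for the derivative $f^{(k+1)}$. For a trust region $[a,b]$ (with $a\le b$) on which the interval evaluation $\mathsf{f}^{(k+1)}([a,b])$ is defined, and for $x_0\in[a,b]$, define $$\tilde I_k(f,x_0,[a,b])=\begin{cases}\frac{1}{k!}f^{(k)}([a,b]) & \text{if } 0\in\mathsf{f}^{(k+1)}([a,b]),\\[4pt] \left[\frac{R_{k-1}(a;f,x_0)}{(a-x_0)^k},\ \frac{R_{k-1}(b;f,x_0)}{(b-x_0)^k}\right] & \text{if the left endpoint of } \mathsf{f}^{(k+1)}([a,b]) \text{ is } >0,\\[4pt] \left[\frac{R_{k-1}(b;f,x_0)}{(b-x_0)^k},\ \frac{R_{k-1}(a;f,x_0)}{(a-x_0)^k}\right] & \text{otherwise,}\end{cases}$$ where, if $x_0$ equals $a$ or $b$, the corresponding quotient $\frac{R_{k-1}(x;f,x_0)}{(x-x_0)^k}$ at $x=x_0$ is understood as its limit $\frac{1}{k!}f^{(k)}(x_0)$ as $x\to x_0$. Then for every such trust region $[a,b]$ and every $x_0\in[a,b]$, the interval $\tilde I_k(f,x_0,[a,b])$ defines a degree $k$ Taylor polynomial enclosure of $f$ at $x_0$ over $[a,b]$, and $$\tilde I_k(f,x_0,[a,b])\subseteq\frac{1}{k!}f^{(k)}([a,b]).$$ Furthermore, if $x_0\in\mathbb{R}$ satisfies $f^{(k+1)}(x_0)\ne 0$ and $\mathsf{f}^{(k+1)}([x_0,x_0+\epsilon])$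 is defined for all sufficiently small $\epsilon>0$, then there exists $\delta>0$ such that $$\tilde I_k(f,x_0,[x_0,x_0+\epsilon])=I^*_k(f,x_0,[x_0,x_0+\epsilon])\quad\text{for all }\epsilon\in(0,\delta].$$
   Context: For an integer $j\ge 0$, $T_j(x;f,x_0)=\sum_{i=0}^{j}\frac{1}{i!}f^{(i)}(x_0)(x-x_0)^i$ and $R_j(x;f,x_0)=f(x)-T_j(x;f,x_0)$. For a closed interval $I$ and $\alpha\in\mathbb{R}$, $I\alpha=\alpha I=\{z\alpha:z\in I\}$. A closed interval $I$ defines a degree $k$ Taylor polynomial enclosure of $f$ at $x_0$ over $[a,b]$ if $R_{k-1}(x;f,x_0)\in I\,(x-x_0)^k$ for all $x\in[a,b]$; the enclosure is then $x\mapsto T_{k-1}(x;f,x_0)+I(x-x_0)^k$. The interval defining the degree $k$ sharp Taylor polynomial enclosure of $f$ at $x_0$ over $[a,b]$ is $$I^*_k(f,x_0,[a,b])=\left[\inf_{x\in[a,b]\setminus\{x_0\}}\frac{R_{k-1}(x;f,x_0)}{(x-x_0)^k},\ \sup_{x\in[a,b]\setminus\{x_0\}}\frac{R_{k-1}(x;f,x_0)}{(x-x_0)^k}\right].$$ $f^{(k)}([a,b])=\{f^{(k)}(y):y\in[a,b]\}$ is the range of $f^{(k)}$ over $[a,b]$, a closed interval. Formulas and interval evaluation: a formula $\mathsf{g}$ for a function $g:\mathbb{R}\to\mathbb{R}$ is a finite expression built from the variable, real constants, and elementary operations (arithmetic operations and standard elementary functions, each a continuous function on its domain), whose value at each $x\in\mathbb{R}$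 is $g(x)$. For a closed interval $I$, $\mathsf{g}(I)$ is the interval obtained by plugging $I$ into the formula in place of the variable and evaluating by interval arithmetic: constants become degenerate intervals, and each elementary operation applied to intervals returns its exact range over the product of these intervals. The evaluation is defined if at every step the product of the input intervals lies in the domain of the operation. *)

theory Defs
  imports "HOL-Analysis.Analysis"
begin

definition real_analytic :: "(real \<Rightarrow> real) \<Rightarrow> bool" where
  "real_analytic f \<longleftrightarrow> (\<forall>x. \<exists>F. (\<lambda>h. f (x + h)) has_fps_expansion F)"

definition taylor_poly :: "nat \<Rightarrow> (real \<Rightarrow> real) \<Rightarrow> real \<Rightarrow> real \<Rightarrow> real" where
  "taylor_poly j f x0 x = (\<Sum>i\<le>j. 1 / fact i * (deriv ^^ i) f x0 * (x - x0) ^ i)"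

definition taylor_rem :: "nat \<Rightarrow> (real \<Rightarrow> real) \<Rightarrow> real \<Rightarrow> real \<Rightarrow> real" where
  "taylor_rem j f x0 x = f x - taylor_poly j f x0 x"

text \<open>The degree \<open>k\<close> is positive, so that \<open>k - 1\<close> does not truncate.\<close>

definition defines_taylor_enclosure ::
  "nat \<Rightarrow> real set \<Rightarrow> (real \<Rightarrow> real) \<Rightarrow> real \<Rightarrow> real \<Rightarrow> real \<Rightarrow> bool" where
  "defines_taylor_enclosure k I f x0 a b \<longleftrightarrow>
     (\<exists>l u. l \<le> u \<and> I = {l..u}) \<and>
     (\<forall>x\<in>{a..b}. taylor_rem (k - 1) f x0 x \<in> (\<lambda>z. z * (x - x0) ^ k) ` I)"

text \<open>The infimum and supremum are those of the reals, so the following is meaningful only if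
  \<open>{a..b} - {x0}\<close> is nonempty and the quotients are bounded on it. For an analytic \<open>f\<close>, they
  are bounded.\<close>

definition sharp_interval :: "nat \<Rightarrow> (real \<Rightarrow> real) \<Rightarrow> real \<Rightarrow> real \<Rightarrow> real \<Rightarrow> real set" where
  "sharp_interval k f x0 a b =
     {(INF x\<in>{a..b} - {x0}. taylor_rem (k - 1) f x0 x / (x - x0) ^ k) ..
      (SUP x\<in>{a..b} - {x0}. taylor_rem (k - 1) f x0 x / (x - x0) ^ k)}"

datatype unary_op =
    Neg | Abs | PowerInt int | Sqrt | Root nat
  | Exp | Ln | Sin | Cos | Tan | Cot | Arcsin | Arccos | Arctan
  | Sinh | Cosh | Tanh | Arsinh | Arcosh | Artanh

datatype binary_op =
    Add | Sub | Mult | Divide | Powr | Log | Minimum | Maximum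

primrec unary_dom :: "unary_op \<Rightarrow> real set" where
  "unary_dom Neg = UNIV"
| "unary_dom Abs = UNIV"
| "unary_dom (PowerInt n) = (if n \<ge> 0 then UNIV else - {0})"
| "unary_dom Sqrt = {0..}"
| "unary_dom (Root n) = (if n = 0 then {} else if even n then {0..} else UNIV)"
| "unary_dom Exp = UNIV"
| "unary_dom Ln = {0<..}"
| "unary_dom Sin = UNIV"
| "unary_dom Cos = UNIV"
| "unary_dom Tan = {x. cos x \<noteq> 0}"
| "unary_dom Cot = {x. sin x \<noteq> 0}"
| "unary_dom Arcsin = {-1..1}"
| "unary_dom Arccos = {-1..1}"
| "unary_dom Arctan = UNIV"
| "unary_dom Sinh = UNIV"
| "unary_dom Cosh = UNIV"
| "unary_dom Tanh = UNIV"
| "unary_dom Arsinh = UNIV"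
| "unary_dom Arcosh = {1..}"
| "unary_dom Artanh = {-1<..<1}"

primrec unary_fun :: "unary_op \<Rightarrow> real \<Rightarrow> real" where
  "unary_fun Neg = uminus"
| "unary_fun Abs = abs"
| "unary_fun (PowerInt n) = (\<lambda>x. x powi n)"
| "unary_fun Sqrt = sqrt"
| "unary_fun (Root n) = root n"
| "unary_fun Exp = exp"
| "unary_fun Ln = ln"
| "unary_fun Sin = sin"
| "unary_fun Cos = cos"
| "unary_fun Tan = tan"
| "unary_fun Cot = cot"
| "unary_fun Arcsin = arcsin"
| "unary_fun Arccos = arccos"
| "unary_fun Arctan = arctan"
| "unary_fun Sinh = sinh"
| "unary_fun Cosh = cosh"
| "unary_fun Tanh = tanh"
| "unary_fun Arsinh = arsinh"
| "unary_fun Arcosh = arcosh"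
| "unary_fun Artanh = artanh"

primrec binary_dom :: "binary_op \<Rightarrow> (real \<times> real) set" where
  "binary_dom Add = UNIV"
| "binary_dom Sub = UNIV"
| "binary_dom Mult = UNIV"
| "binary_dom Divide = {(x, y). y \<noteq> 0}"
| "binary_dom Powr = {(x, y). x > 0 \<or> x = 0 \<and> y > 0}"
| "binary_dom Log = {(b, x). b > 0 \<and> b \<noteq> 1 \<and> x > 0}"
| "binary_dom Minimum = UNIV"
| "binary_dom Maximum = UNIV"

primrec binary_fun :: "binary_op \<Rightarrow> real \<times> real \<Rightarrow> real" where
  "binary_fun Add = (\<lambda>(x, y). x + y)"
| "binary_fun Sub = (\<lambda>(x, y). x - y)"
| "binary_fun Mult = (\<lambda>(x, y). x * y)"
| "binary_fun Divide = (\<lambda>(x, y). x / y)"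
| "binary_fun Powr = (\<lambda>(x, y). x powr y)"
| "binary_fun Log = (\<lambda>(b, x). log b x)"
| "binary_fun Minimum = (\<lambda>(x, y). min x y)"
| "binary_fun Maximum = (\<lambda>(x, y). max x y)"

lemma continuous_on_unary_fun: "continuous_on (unary_dom p) (unary_fun p)"
proof (cases p)
  case (PowerInt n)
  have "continuous_on (unary_dom (PowerInt n)) (\<lambda>x::real. x powi n)"
    by (cases "n \<ge> 0") (auto simp: power_int_def intro!: continuous_intros)
  then show ?thesis using PowerInt by simp
qed (auto intro!: continuous_intros continuous_on_arcosh continuous_on_artanh)

lemma continuous_on_binary_fun: "continuous_on (binary_dom p) (binary_fun p)"
proof (cases p)
  case Powr
  then show ?thesis
    by (auto simp: case_prod_beta intro!: continuous_on_powr' continuous_on_fst continuous_on_snd continuous_on_id)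
qed (auto simp: case_prod_beta intro!: continuous_intros)

datatype formula =
    Var
  | Const real
  | Unary unary_op formula
  | Binary binary_op formula formula

text \<open>Both evaluations are partial: \<open>None\<close> means that some operation is applied outside its
  domain.\<close>

primrec eval_at :: "formula \<Rightarrow> real \<Rightarrow> real option" where
  "eval_at Var x = Some x"
| "eval_at (Const c) x = Some c"
| "eval_at (Unary p \<phi>) x =
     (case eval_at \<phi> x of
        Some y \<Rightarrow> if y \<in> unary_dom p then Some (unary_fun p y) else None
      | None \<Rightarrow> None)"
| "eval_at (Binary p \<phi> \<psi>) x =
     (case (eval_at \<phi> x, eval_at \<psi> x) of
        (Some y, Some z) \<Rightarrow>
          if (y, z) \<in> binary_dom p then Some (binary_fun p (y, z)) else None
      | _ \<Rightarrow> None)"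

primrec eval_interval :: "formula \<Rightarrow> real set \<Rightarrow> real set option" where
  "eval_interval Var I = Some I"
| "eval_interval (Const c) I = Some {c}"
| "eval_interval (Unary p \<phi>) I =
     (case eval_interval \<phi> I of
        Some A \<Rightarrow> if A \<subseteq> unary_dom p then Some (unary_fun p ` A) else None
      | None \<Rightarrow> None)"
| "eval_interval (Binary p \<phi> \<psi>) I =
     (case (eval_interval \<phi> I, eval_interval \<psi> I) of
        (Some A, Some B) \<Rightarrow>
          if A \<times> B \<subseteq> binary_dom p then Some (binary_fun p ` (A \<times> B)) else None
      | _ \<Rightarrow> None)"

definition formula_for :: "formula \<Rightarrow> (real \<Rightarrow> real) \<Rightarrow> bool" where
  "formula_for \<phi> g \<longleftrightarrow> (\<forall>x. eval_at \<phi> x = Some (g x))"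

definition interval_defined :: "formula \<Rightarrow> real \<Rightarrow> real \<Rightarrow> bool" where
  "interval_defined \<phi> a b \<longleftrightarrow> eval_interval \<phi> {a..b} \<noteq> None"

text \<open>Although intervals are evaluated as sets, the result on a closed interval is again a
  closed interval; in particular its infimum is its left endpoint.\<close>

lemma eval_interval_closed_interval:
  assumes "a \<le> b" "eval_interval \<phi> {a..b} = Some J"
  shows "\<exists>l u. l \<le> u \<and> J = {l..u}"
proof -
  have *: "\<exists>l u. l \<le> u \<and> g ` S = {l..u}"
    if "continuous_on D g" "S \<subseteq> D" "compact S" "connected S" "S \<noteq> {}"
    for g :: "'c::topological_space \<Rightarrow> real" and S D
  proof -
    have cont: "continuous_on S g" by (rule continuous_on_subset[OF that(1,2)])
    have "compact (g ` S)" by (rule compact_continuous_image[OF cont that(3)])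
    moreover have "connected (g ` S)" by (rule connected_continuous_image[OF cont that(4)])
    ultimately have "\<exists>l u. g ` S = {l..u}" using connected_compact_interval_1[of "g ` S"] by metis
    then obtain l u where "g ` S = {l..u}" by blast
    moreover have "g ` S \<noteq> {}" using that(5) by simp
    ultimately show ?thesis by auto
  qed
  show ?thesis using assms(2)
  proof (induction \<phi> arbitrary: J)
    case Var
    then show ?case using assms(1) by auto
  next
    case (Const c)
    then have "J = {c..c}" by auto
    then show ?case by blast
  next
    case (Unary p \<phi>)
    then obtain A where A: "eval_interval \<phi> {a..b} = Some A" "A \<subseteq> unary_dom p"
      "J = unary_fun p ` A" by (auto split: option.splits if_splits)
    then obtain l u where "l \<le> u" "A = {l..u}" using Unary.IH by blast
    then show ?case unfolding A(3)
      by (intro *[OF continuous_on_unary_fun A(2)]) auto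
  next
    case (Binary p \<phi> \<psi>)
    then obtain A B where AB: "eval_interval \<phi> {a..b} = Some A"
      "eval_interval \<psi> {a..b} = Some B" "A \<times> B \<subseteq> binary_dom p"
      "J = binary_fun p ` (A \<times> B)" by (auto split: option.splits if_splits)
    then obtain l u l' u' where "l \<le> u" "A = {l..u}" "l' \<le> u'" "B = {l'..u'}"
      using Binary.IH(1)[OF AB(1)] Binary.IH(2)[OF AB(2)] by blast
    then show ?case unfolding AB(4)
      by (intro *[OF continuous_on_binary_fun AB(3)]) (auto intro!: compact_Times connected_Times)
  qed
qed

definition taylor_quot :: "nat \<Rightarrow> (real \<Rightarrow> real) \<Rightarrow> real \<Rightarrow> real \<Rightarrow> real" where
  "taylor_quot k f x0 x =
     (if x = x0 then 1 / fact k * (deriv ^^ k) f x0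
      else taylor_rem (k - 1) f x0 x / (x - x0) ^ k)"

text \<open>Meaningful only if \<open>interval_defined \<phi> a b\<close>; here \<open>\<phi>\<close> is a formula for the derivative of
  order \<open>k + 1\<close>.\<close>

definition tilde_interval ::
  "formula \<Rightarrow> nat \<Rightarrow> (real \<Rightarrow> real) \<Rightarrow> real \<Rightarrow> real \<Rightarrow> real \<Rightarrow> real set" where
  "tilde_interval \<phi> k f x0 a b =
     (let J = the (eval_interval \<phi> {a..b}) in
      if 0 \<in> J then (\<lambda>z. 1 / fact k * z) ` (deriv ^^ k) f ` {a..b}
      else if Inf J > 0 then {taylor_quot k f x0 a .. taylor_quot k f x0 b}
      else {taylor_quot k f x0 b .. taylor_quot k f x0 a})"

end

theory Submission
  imports Defs
begin

text \<open>
  Everything rests on the integral form of the remainder, rescaled to the unit interval. For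
  \<open>k > 0\<close>, the quotient \<open>q(x) = R\<^bsub>k-1\<^esub>(x) / (x - x\<^sub>0)\<^bsup>k\<^esup>\<close>, extended to \<open>x = x\<^sub>0\<close> by its limit, is
  the integral over \<open>t\<close> from 0 to 1 of
  \<open>(1 - t)\<^bsup>k-1\<^esup> / (k-1)! * f\<^bsup>(k)\<^esup>(x\<^sub>0 + t (x - x\<^sub>0))\<close> (\<open>taylor_quot_has_integral\<close>). The weight is
  nonnegative, has total mass \<open>1 / k!\<close> and does not depend on \<open>x\<close>. Two things follow.
  \<^item> The number \<open>k! q(x)\<close> is an average of values of \<open>f\<^bsup>(k)\<^esup>\<close> between \<open>x\<^sub>0\<close> and \<open>x\<close>, hence
    itself such a value (\<open>taylor_quot_in_range\<close>). So the range of \<open>f\<^bsup>(k)\<^esup> / k!\<close> gives an enclosure.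
  \<^item> If \<open>f\<^bsup>(k)\<^esup>\<close> is monotone on \<open>[a,b]\<close>, then so is \<open>q\<close>, because each point
    \<open>x\<^sub>0 + t (x - x\<^sub>0)\<close> is nondecreasing in \<open>x\<close>, on either side of \<open>x\<^sub>0\<close>. Then the values of \<open>q\<close> at
    \<open>a\<close> and \<open>b\<close> bound it.

  The interval evaluation of a formula for \<open>f\<^bsup>(k+1)\<^esup>\<close> contains all values of \<open>f\<^bsup>(k+1)\<^esup>\<close> on \<open>[a,b]\<close>.
  If it omits 0, it lies on one side of 0, because it is an interval, and \<open>f\<^bsup>(k)\<^esup>\<close> is monotone. This
  proves the enclosure and the inclusion.

  For the sharpness, interval evaluation is continuous at a point: as the interval shrinks to
  \<open>x\<^sub>0\<close>, the result shrinks to the value at \<open>x\<^sub>0\<close> (\<open>eventually_eval_interval_subset\<close>). If that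
  value is not 0, then for small \<open>\<epsilon>\<close> the monotone case applies, and there the extreme values
  of \<open>q\<close> over \<open>(x\<^sub>0, x\<^sub>0 + \<epsilon>]\<close> are its limit at \<open>x\<^sub>0\<close> and its value at \<open>x\<^sub>0 + \<epsilon>\<close>, exactly the ends
  of the computed interval.
\<close>

section \<open>Derivatives of real analytic functions\<close>

lemma real_analytic_deriv:
  assumes "real_analytic f"
  shows "real_analytic (deriv f)"
  unfolding real_analytic_def
proof
  fix x
  obtain F where "(\<lambda>h. f (x + h)) has_fps_expansion F"
    using assms by (auto simp: real_analytic_def)
  then have "deriv (\<lambda>h. f (x + h)) has_fps_expansion fps_deriv F"
    by (rule has_fps_expansion_deriv)
  moreover have "deriv (\<lambda>h. f (x + h)) = (\<lambda>h. deriv f (x + h))"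
    by (simp add: deriv_def add.commute[of x] DERIV_shift fun_eq_iff)
  ultimately show "\<exists>F. (\<lambda>h. deriv f (x + h)) has_fps_expansion F"
    by auto
qed

lemma real_analytic_DERIV:
  assumes "real_analytic f"
  shows "(f has_real_derivative deriv f x) (at x)"
proof -
  obtain F where F: "(\<lambda>h. f (x + h)) has_fps_expansion F"
    using assms by (auto simp: real_analytic_def)
  then have "\<forall>\<^sub>F h in nhds 0. eval_fps F h = f (x + h)"
    by (simp add: has_fps_expansion_def)
  moreover have "(eval_fps F has_real_derivative eval_fps (fps_deriv F) 0) (at 0)"
    using F by (intro has_field_derivative_eval_fps) (auto simp: has_fps_expansion_def zero_ereal_def)
  ultimately have "((\<lambda>h. f (x + h)) has_real_derivative eval_fps (fps_deriv F) 0) (at 0)"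
    by (rule iffD1[OF DERIV_cong_ev[OF refl _ refl]])
  then have "(f has_real_derivative eval_fps (fps_deriv F) 0) (at x)"
    using DERIV_shift[of f _ 0 x] by (simp add: add.commute)
  then show ?thesis
    by (simp add: DERIV_imp_deriv)
qed

lemma real_analytic_higher_DERIV:
  assumes "real_analytic f"
  shows "((deriv ^^ n) f has_real_derivative (deriv ^^ Suc n) f x) (at x)"
proof -
  have "real_analytic ((deriv ^^ n) f)"
    using assms by (induction n) (auto intro: real_analytic_deriv)
  then show ?thesis
    using real_analytic_DERIV by simp
qed

section \<open>The Taylor quotient as an average of the derivative\<close>

lemma segment_mem_Icc:
  fixes x y t :: real
  assumes "x \<in> {a..b}" "y \<in> {a..b}" "t \<in> {0..1}"
  shows "x + t * (y - x) \<in> {a..b}"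
  using convexD_alt[of "{a..b}" x y t] assms by (auto simp: algebra_simps)

text \<open>The weight of the integral remainder has mass \<open>1 / k!\<close>. This makes the integral formula
  below agree with the value of the quotient at the centre.\<close>

lemma taylor_weight_has_integral:
  assumes "k > 0"
  shows "((\<lambda>t::real. (1 - t) ^ (k - 1) / fact (k - 1)) has_integral 1 / fact k) {0..1}"
proof -
  obtain m where m: "k = Suc m"
    using assms by (cases k) auto
  have "((\<lambda>t::real. - ((1 - t) ^ Suc m / fact (Suc m))) has_vector_derivative
      (1 - t) ^ m / fact m) (at t within {0..1})" for t
  proof -
    have "((\<lambda>t::real. 1 - t) has_real_derivative 0 - 1) (at t)"
      by (intro DERIV_diff DERIV_const DERIV_ident)
    then have "((\<lambda>t::real. - ((1 - t) ^ Suc m / fact (Suc m))) has_real_derivative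
        - ((1 + of_nat m) * ((0 - 1) * (1 - t) ^ m) / fact (Suc m))) (at t)"
      by (intro DERIV_minus DERIV_cdivide DERIV_power_Suc)
    moreover have "- ((1 + of_nat m) * ((0 - 1) * c) / fact (Suc m)) = c / fact m" for c :: real
    proof -
      have "1 + real m \<noteq> 0"
        by simp
      then show ?thesis
        by simp
    qed
    ultimately have "((\<lambda>t::real. - ((1 - t) ^ Suc m / fact (Suc m))) has_real_derivative
        (1 - t) ^ m / fact m) (at t)"
      by (simp only:)
    then show ?thesis
      unfolding has_real_derivative_iff_has_vector_derivative
      by (rule has_vector_derivative_at_within)
  qed
  then have "((\<lambda>t::real. (1 - t) ^ m / fact m) has_integral
        - ((1 - 1) ^ Suc m / fact (Suc m)) - - ((1 - 0) ^ Suc m / fact (Suc m))) {0..1}"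
    by (intro fundamental_theorem_of_calculus) auto
  then show ?thesis
    by (simp add: m)
qed

context
  fixes f :: "real \<Rightarrow> real"
  assumes smooth: "\<And>n x. ((deriv ^^ n) f has_real_derivative (deriv ^^ Suc n) f x) (at x)"
begin

lemma continuous_on_higher_deriv: "continuous_on A ((deriv ^^ n) f)"
  by (rule DERIV_continuous_on, rule has_field_derivative_at_within, rule smooth)

text \<open>Taylor's formula with integral remainder, applied to \<open>t \<mapsto> f(x\<^sub>0 + t h)\<close> on the unit interval
  with \<open>h = x - x\<^sub>0\<close>: the \<open>k\<close>-th derivative in \<open>t\<close> carries a factor \<open>h\<^bsup>k\<^esup>\<close>, which cancels in the
  quotient. Integrating over \<open>t\<close> instead of from \<open>x\<^sub>0\<close> to \<open>x\<close> avoids a distinction by the sign of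
  \<open>h\<close> and makes the domain of integration independent of \<open>x\<close>, so that quotients can be compared
  under the integral.\<close>

lemma taylor_quot_has_integral:
  assumes "k > 0"
  shows "((\<lambda>t. (1 - t) ^ (k - 1) / fact (k - 1) * (deriv ^^ k) f (x0 + t * (x - x0)))
           has_integral taylor_quot k f x0 x) {0..1}"
proof (cases "x = x0")
  case True
  have "((\<lambda>t::real. (1 - t) ^ (k - 1) / fact (k - 1) * (deriv ^^ k) f x0)
      has_integral 1 / fact k * (deriv ^^ k) f x0) {0..1}"
    using taylor_weight_has_integral[OF assms] by (rule has_integral_mult_left)
  then show ?thesis
    using True by (simp add: taylor_quot_def)
next
  case False
  define h where "h = x - x0"
  define D where "D i t = h ^ i * (deriv ^^ i) f (x0 + t * h)" for i t
  have "(D m has_vector_derivative D (Suc m) t) (at t within {0..1})" for m t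
  proof -
    have "((\<lambda>t. (deriv ^^ m) f (x0 + t * h)) has_real_derivative
        (deriv ^^ Suc m) f (x0 + t * h) * h) (at t)"
      by (rule DERIV_chain2[OF smooth]) (auto intro!: derivative_eq_intros)
    then have "(D m has_real_derivative h ^ m * ((deriv ^^ Suc m) f (x0 + t * h) * h)) (at t)"
      unfolding D_def by (rule DERIV_cmult)
    then have "(D m has_real_derivative D (Suc m) t) (at t)"
      by (simp add: D_def mult_ac)
    then show ?thesis
      unfolding has_real_derivative_iff_has_vector_derivative
      by (rule has_vector_derivative_at_within)
  qed
  then have "((\<lambda>t. ((1 - t) ^ (k - 1) / fact (k - 1)) *\<^sub>R D k t)
    has_integral D 0 1 - (\<Sum>i<k. ((1 - 0) ^ i / fact i) *\<^sub>R D i 0)) {0..1}"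
    by (intro Taylor_has_integral[OF assms refl]) auto
  moreover have "D 0 1 - (\<Sum>i<k. ((1 - 0) ^ i / fact i) *\<^sub>R D i 0) = taylor_rem (k - 1) f x0 x"
  proof -
    have "{..<k} = {..k - 1}"
      using assms by auto
    then show ?thesis
      by (simp add: D_def taylor_rem_def taylor_poly_def h_def mult_ac)
  qed
  ultimately have "((\<lambda>t. (1 - t) ^ (k - 1) / fact (k - 1) * D k t)
    has_integral taylor_rem (k - 1) f x0 x) {0..1}"
    by (simp only: real_scaleR_def)
  then have "((\<lambda>t. (1 - t) ^ (k - 1) / fact (k - 1) * D k t / h ^ k)
    has_integral taylor_rem (k - 1) f x0 x / h ^ k) {0..1}"
    by (rule has_integral_divide)
  then show ?thesis
    using False by (simp add: D_def taylor_quot_def h_def)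
qed

text \<open>At \<open>x = x\<^sub>0\<close> both sides vanish because \<open>k > 0\<close>, so the convention for the quotient there
  does no harm.\<close>

lemma taylor_rem_eq_taylor_quot:
  assumes "k > 0"
  shows "taylor_rem (k - 1) f x0 x = taylor_quot k f x0 x * (x - x0) ^ k"
proof (cases "x = x0")
  case True
  have "(\<Sum>i\<le>k - 1. (deriv ^^ i) f x0 * 0 ^ i / fact i) = (\<Sum>i\<le>k - 1. if i = 0 then f x0 else 0)"
    by (intro sum.cong) (auto simp: power_0_left)
  then show ?thesis
    using True assms by (simp add: taylor_rem_def taylor_poly_def)
qed (simp add: taylor_quot_def)

text \<open>Two centres are allowed, so that one rule serves both to bound a quotient by a value
  \<open>f\<^bsup>(k)\<^esup>(y) / k!\<close>, which is the quotient at \<open>y\<close> with centre \<open>y\<close>, and to compare quotients with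
  the same centre.\<close>

lemma taylor_quot_le:
  assumes "k > 0"
    and "\<And>t. t \<in> {0..1} \<Longrightarrow>
      (deriv ^^ k) f (x0 + t * (x - x0)) \<le> (deriv ^^ k) f (y0 + t * (y - y0))"
  shows "taylor_quot k f x0 x \<le> taylor_quot k f y0 y"
  using taylor_quot_has_integral[OF assms(1)] taylor_quot_has_integral[OF assms(1)]
  by (rule has_integral_le) (auto intro!: divide_right_mono mult_left_mono assms(2))

text \<open>The average of \<open>f\<^bsup>(k)\<^esup>\<close> lies between its extreme values, and the intermediate value theorem
  makes it a value of \<open>f\<^bsup>(k)\<^esup>\<close>.\<close>

lemma taylor_quot_in_range:
  assumes "k > 0" "x \<in> {a..b}" "x0 \<in> {a..b}"
  shows "taylor_quot k f x0 x \<in> (\<lambda>z. 1 / fact k * z) ` (deriv ^^ k) f ` {a..b}"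
proof -
  let ?g = "(deriv ^^ k) f"
  have seg: "x0 + t * (x - x0) \<in> {a..b}" if "t \<in> {0..1}" for t
    using segment_mem_Icc assms(2,3) that by blast
  have ne: "{a..b} \<noteq> {}"
    using assms by auto
  obtain y where y: "y \<in> {a..b}" "\<And>z. z \<in> {a..b} \<Longrightarrow> ?g y \<le> ?g z"
    using continuous_attains_inf[OF compact_Icc ne continuous_on_higher_deriv] by blast
  obtain z where z: "z \<in> {a..b}" "\<And>y. y \<in> {a..b} \<Longrightarrow> ?g y \<le> ?g z"
    using continuous_attains_sup[OF compact_Icc ne continuous_on_higher_deriv] by blast
  have "taylor_quot k f y y \<le> taylor_quot k f x0 x" "taylor_quot k f x0 x \<le> taylor_quot k f z z"
    using y z seg by (auto intro!: taylor_quot_le assms(1))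
  then have "?g y \<le> fact k * taylor_quot k f x0 x" "fact k * taylor_quot k f x0 x \<le> ?g z"
    by (auto simp: taylor_quot_def[of _ _ y] taylor_quot_def[of _ _ z] field_simps)
  moreover have "connected (?g ` {a..b})"
    by (intro connected_continuous_image continuous_on_higher_deriv connected_Icc)
  ultimately have "fact k * taylor_quot k f x0 x \<in> ?g ` {a..b}"
    using y(1) z(1) by (meson connectedD_interval imageI)
  then have "1 / fact k * (fact k * taylor_quot k f x0 x) \<in> (\<lambda>z. 1 / fact k * z) ` ?g ` {a..b}"
    by (rule imageI)
  then show ?thesis
    by simp
qed

text \<open>By the preceding lemma on the interval between \<open>x\<^sub>0\<close> and \<open>x\<close>, the quotient is a value of
  \<open>f\<^bsup>(k)\<^esup> / k!\<close> at a point that tends to \<open>x\<^sub>0\<close>.\<close>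

lemma taylor_quot_tendsto: "k > 0 \<Longrightarrow> (taylor_quot k f x0 \<longlongrightarrow> taylor_quot k f x0 x0) (at x0)"
proof (rule tendstoI)
  fix e :: real
  assume k: "k > 0" and e: "e > 0"
  let ?g = "\<lambda>y. 1 / fact k * (deriv ^^ k) f y"
  have "isCont ?g x0"
    using continuous_on_higher_deriv[of UNIV k]
    by (intro continuous_intros) (auto simp: continuous_on_eq_continuous_at)
  then obtain d where d: "d > 0" "\<And>y. dist y x0 < d \<Longrightarrow> dist (?g y) (?g x0) < e"
    using e unfolding continuous_at_eps_delta dist_norm real_norm_def by blast
  have "dist (taylor_quot k f x0 x) (taylor_quot k f x0 x0) < e" if "dist x x0 < d" for x
  proof -
    obtain y where "y \<in> {min x x0..max x x0}" "taylor_quot k f x0 x = ?g y"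
      using taylor_quot_in_range[OF k, of x "min x x0" "max x x0" x0] by auto
    moreover from this that have "dist y x0 < d"
      by (auto simp: dist_real_def)
    ultimately show ?thesis
      using d(2) by (simp add: taylor_quot_def[of _ _ x0 x0])
  qed
  then show "\<forall>\<^sub>F x in at x0. dist (taylor_quot k f x0 x) (taylor_quot k f x0 x0) < e"
    using d(1) by (auto simp: eventually_at)
qed

text \<open>For fixed \<open>t \<ge> 0\<close>, the point \<open>x\<^sub>0 + t (x - x\<^sub>0)\<close> is nondecreasing in \<open>x\<close>, so the integrand inherits
  the monotonicity of \<open>f\<^bsup>(k)\<^esup>\<close>.\<close>

lemma taylor_quot_mono:
  assumes "k > 0" "x0 \<in> {a..b}" "x \<in> {a..b}" "y \<in> {a..b}" "x \<le> y"
    and "\<And>z. z \<in> {a..b} \<Longrightarrow> (deriv ^^ Suc k) f z \<ge> 0"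
  shows "taylor_quot k f x0 x \<le> taylor_quot k f x0 y"
proof (rule taylor_quot_le[OF assms(1)])
  fix t :: real
  assume t: "t \<in> {0..1}"
  have seg: "x0 + t * (u - x0) \<in> {a..b}" if "u \<in> {a..b}" for u
    using segment_mem_Icc assms(2) that t by blast
  have "x0 + t * (x - x0) \<le> x0 + t * (y - x0)"
    using t assms(5) by (auto intro: mult_left_mono)
  then show "(deriv ^^ k) f (x0 + t * (x - x0)) \<le> (deriv ^^ k) f (x0 + t * (y - x0))"
  proof (rule DERIV_nonneg_imp_nondecreasing)
    fix u
    assume "x0 + t * (x - x0) \<le> u" "u \<le> x0 + t * (y - x0)"
    then have "u \<in> {a..b}"
      using seg[OF assms(3)] seg[OF assms(4)] by auto
    then show "\<exists>v. ((deriv ^^ k) f has_real_derivative v) (at u) \<and> v \<ge> 0"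
      using smooth assms(6) by blast
  qed
qed

lemma taylor_quot_antimono:
  assumes "k > 0" "x0 \<in> {a..b}" "x \<in> {a..b}" "y \<in> {a..b}" "x \<le> y"
    and "\<And>z. z \<in> {a..b} \<Longrightarrow> (deriv ^^ Suc k) f z \<le> 0"
  shows "taylor_quot k f x0 y \<le> taylor_quot k f x0 x"
proof (rule taylor_quot_le[OF assms(1)])
  fix t :: real
  assume t: "t \<in> {0..1}"
  have seg: "x0 + t * (u - x0) \<in> {a..b}" if "u \<in> {a..b}" for u
    using segment_mem_Icc assms(2) that t by blast
  have "x0 + t * (x - x0) \<le> x0 + t * (y - x0)"
    using t assms(5) by (auto intro: mult_left_mono)
  then show "(deriv ^^ k) f (x0 + t * (y - x0)) \<le> (deriv ^^ k) f (x0 + t * (x - x0))"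
  proof (rule DERIV_nonpos_imp_nonincreasing)
    fix u
    assume "x0 + t * (x - x0) \<le> u" "u \<le> x0 + t * (y - x0)"
    then have "u \<in> {a..b}"
      using seg[OF assms(3)] seg[OF assms(4)] by auto
    then show "\<exists>v. ((deriv ^^ k) f has_real_derivative v) (at u) \<and> v \<le> 0"
      using smooth assms(6) by blast
  qed
qed

lemma sharp_interval_eq:
  "sharp_interval k f x0 x0 b =
     {Inf (taylor_quot k f x0 ` {x0<..b}) .. Sup (taylor_quot k f x0 ` {x0<..b})}"
proof -
  have "(\<lambda>x. taylor_rem (k - 1) f x0 x / (x - x0) ^ k) ` ({x0..b} - {x0})
      = taylor_quot k f x0 ` {x0<..b}"
    by (auto simp: taylor_quot_def)
  then show ?thesis
    unfolding sharp_interval_def by (rule arg_cong)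
qed

text \<open>Monotonicity puts the infimum at the left end, which the sharp interval leaves out; it is
  recovered as a limit. The supremum is attained at the right end.\<close>

lemma sharp_interval_mono:
  assumes "k > 0" "x0 < b" "\<And>z. z \<in> {x0..b} \<Longrightarrow> (deriv ^^ Suc k) f z \<ge> 0"
  shows "sharp_interval k f x0 x0 b = {taylor_quot k f x0 x0 .. taylor_quot k f x0 b}"
proof -
  let ?q = "taylor_quot k f x0"
  have mono: "?q x \<le> ?q y" if "x \<in> {x0..b}" "y \<in> {x0..b}" "x \<le> y" for x y
    using taylor_quot_mono[of k x0 x0 b x y] assms that by auto
  have lim: "(?q \<longlongrightarrow> ?q x0) (at_right x0)"
    using taylor_quot_tendsto[OF assms(1)] by (rule tendsto_mono[rotated]) (simp add: at_le)
  have "\<forall>\<^sub>F x in at_right x0. x \<in> {x0<..b}"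
    using assms(2) by (auto simp: eventually_at_right intro!: exI[of _ b])
  then have "y \<le> ?q x0" if "\<And>v. v \<in> ?q ` {x0<..b} \<Longrightarrow> y \<le> v" for y
    using that by (intro tendsto_lowerbound[OF lim]) (auto elim: eventually_mono)
  then have "Inf (?q ` {x0<..b}) = ?q x0"
    using assms(2) mono by (intro cInf_eq_non_empty) auto
  moreover have "Sup (?q ` {x0<..b}) = ?q b"
    using assms(2) mono by (intro cSup_eq_maximum) auto
  ultimately show ?thesis
    by (simp add: sharp_interval_eq)
qed

lemma sharp_interval_antimono:
  assumes "k > 0" "x0 < b" "\<And>z. z \<in> {x0..b} \<Longrightarrow> (deriv ^^ Suc k) f z \<le> 0"
  shows "sharp_interval k f x0 x0 b = {taylor_quot k f x0 b .. taylor_quot k f x0 x0}"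
proof -
  let ?q = "taylor_quot k f x0"
  have antimono: "?q y \<le> ?q x" if "x \<in> {x0..b}" "y \<in> {x0..b}" "x \<le> y" for x y
    using taylor_quot_antimono[of k x0 x0 b x y] assms that by auto
  have lim: "(?q \<longlongrightarrow> ?q x0) (at_right x0)"
    using taylor_quot_tendsto[OF assms(1)] by (rule tendsto_mono[rotated]) (simp add: at_le)
  have "\<forall>\<^sub>F x in at_right x0. x \<in> {x0<..b}"
    using assms(2) by (auto simp: eventually_at_right intro!: exI[of _ b])
  then have "?q x0 \<le> y" if "\<And>v. v \<in> ?q ` {x0<..b} \<Longrightarrow> v \<le> y" for y
    using that by (intro tendsto_upperbound[OF lim]) (auto elim: eventually_mono)
  then have "Sup (?q ` {x0<..b}) = ?q x0"
    using assms(2) antimono by (intro cSup_eq_non_empty) auto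
  moreover have "Inf (?q ` {x0<..b}) = ?q b"
    using assms(2) antimono by (intro cInf_eq_minimum) auto
  ultimately show ?thesis
    by (simp add: sharp_interval_eq)
qed

end

section \<open>Interval evaluation of formulas\<close>

text \<open>The fundamental property of interval arithmetic; it turns the sign of the evaluated
  interval into a sign of \<open>f\<^bsup>(k+1)\<^esup>\<close> on the trust region.\<close>

lemma eval_at_in_eval_interval:
  assumes "eval_at \<phi> x = Some y" "eval_interval \<phi> I = Some J" "x \<in> I"
  shows "y \<in> J"
  using assms
proof (induction \<phi> arbitrary: y J)
  case (Unary p \<phi>)
  then show ?case by (fastforce split: option.splits if_splits)
next
  case (Binary p \<phi> \<psi>)
  from Binary.prems obtain u v where uv: "eval_at \<phi> x = Some u" "eval_at \<psi> x = Some v"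
    "y = binary_fun p (u, v)" by (auto split: option.splits if_splits)
  from Binary.prems obtain A B where "eval_interval \<phi> I = Some A" "eval_interval \<psi> I = Some B"
    "J = binary_fun p ` (A \<times> B)" by (auto split: option.splits if_splits)
  with uv Binary.IH Binary.prems(3) show ?case by blast
qed auto

text \<open>Interval evaluation is continuous at a point. Since every elementary operation is continuous
  on its domain, a neighbourhood of its value comes from a neighbourhood of its arguments, and the
  induction passes that neighbourhood down to the subformulas. Continuity holds only relative to
  the domain, which is why the evaluation must be defined on the shrinking sets: \<open>sqrt x\<close>
  has a value at 0, but no evaluation on any neighbourhood of 0.\<close>

lemma eventually_eval_interval_subset:
  assumes "\<And>U. open U \<Longrightarrow> x \<in> U \<Longrightarrow> \<forall>\<^sub>F e in F. S e \<subseteq> U"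
    and "\<forall>\<^sub>F e in F. eval_interval \<phi> (S e) \<noteq> None"
    and "eval_at \<phi> x = Some y" "open U" "y \<in> U"
  shows "\<forall>\<^sub>F e in F. the (eval_interval \<phi> (S e)) \<subseteq> U"
  using assms(2-)
proof (induction \<phi> arbitrary: y U)
  case Var
  then show ?case using assms(1) by simp
next
  case (Const c)
  then show ?case by simp
next
  case (Unary p \<phi>)
  from Unary.prems(2) obtain u where u: "eval_at \<phi> x = Some u" "u \<in> unary_dom p"
    "y = unary_fun p u" by (auto split: option.splits if_splits)
  \<comment> \<open>Openness in the domain only: \<open>V\<close> can contain points at which the operation is undefined.\<close>
  obtain V where V: "open V" "V \<inter> unary_dom p = unary_fun p -` U \<inter> unary_dom p"
    using continuous_on_unary_fun Unary.prems(3) unfolding continuous_on_open_invariant by metis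
  have "\<forall>\<^sub>F e in F. eval_interval \<phi> (S e) \<noteq> None"
    using Unary.prems(1) by (rule eventually_mono) (auto split: option.splits)
  then have "\<forall>\<^sub>F e in F. the (eval_interval \<phi> (S e)) \<subseteq> V"
    using u V Unary.prems(4) by (intro Unary.IH) auto
  with Unary.prems(1) show ?case
    by eventually_elim (use V(2) in \<open>fastforce split: option.splits if_splits\<close>)
next
  case (Binary p \<phi> \<psi>)
  from Binary.prems(2) obtain u v where uv: "eval_at \<phi> x = Some u" "eval_at \<psi> x = Some v"
    "(u, v) \<in> binary_dom p" "y = binary_fun p (u, v)" by (auto split: option.splits if_splits)
  obtain W where W: "open W" "W \<inter> binary_dom p = binary_fun p -` U \<inter> binary_dom p"
    using continuous_on_binary_fun Binary.prems(3) unfolding continuous_on_open_invariant by metis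
  have "(u, v) \<in> W"
    using uv W(2) Binary.prems(4) by blast
  then obtain V V' where V: "open V" "open V'" "u \<in> V" "v \<in> V'" "V \<times> V' \<subseteq> W"
    using W(1) by (metis mem_Sigma_iff open_prod_elim)
  have "\<forall>\<^sub>F e in F. eval_interval \<phi> (S e) \<noteq> None" "\<forall>\<^sub>F e in F. eval_interval \<psi> (S e) \<noteq> None"
    using Binary.prems(1) by (auto elim!: eventually_mono split: option.splits)
  then have "\<forall>\<^sub>F e in F. the (eval_interval \<phi> (S e)) \<subseteq> V"
    "\<forall>\<^sub>F e in F. the (eval_interval \<psi> (S e)) \<subseteq> V'"
    using uv V by (auto intro!: Binary.IH)
  with Binary.prems(1) show ?case
  proof eventually_elim
    case (elim e)
    then obtain A B where AB: "eval_interval \<phi> (S e) = Some A" "eval_interval \<psi> (S e) = Some B"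
      "A \<times> B \<subseteq> binary_dom p" by (auto split: option.splits if_splits)
    then have "A \<times> B \<subseteq> W \<inter> binary_dom p"
      using elim V(5) by auto
    then show ?case
      using AB W(2) by auto
  qed
qed

lemma eventually_Icc_subset_open:
  fixes x :: real
  assumes "open U" "x \<in> U"
  shows "\<forall>\<^sub>F \<epsilon> in at_right 0. {x..x + \<epsilon>} \<subseteq> U"
proof -
  obtain d where d: "d > 0" "\<And>y. dist y x < d \<Longrightarrow> y \<in> U"
    using assms by (metis open_dist)
  have "{x..x + \<epsilon>} \<subseteq> U" if "0 < \<epsilon>" "\<epsilon> < d" for \<epsilon>
    using d(2) that by (auto simp: dist_real_def)
  then show ?thesis
    using d(1) by (auto simp: eventually_at_right)
qed

section \<open>The enclosure\<close>

lemma tilde_interval_zero_mem: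
  assumes "eval_interval \<phi> {a..b} = Some J" "0 \<in> J"
  shows "tilde_interval \<phi> k f x0 a b = (\<lambda>z. 1 / fact k * z) ` (deriv ^^ k) f ` {a..b}"
  using assms by (simp add: tilde_interval_def)

lemma tilde_interval_pos:
  assumes "eval_interval \<phi> {a..b} = Some J" "a \<le> b" "J \<subseteq> {0<..}"
  shows "tilde_interval \<phi> k f x0 a b = {taylor_quot k f x0 a .. taylor_quot k f x0 b}"
  using eval_interval_closed_interval[OF assms(2,1)] assms
  by (auto simp: tilde_interval_def)

lemma tilde_interval_neg:
  assumes "eval_interval \<phi> {a..b} = Some J" "a \<le> b" "J \<subseteq> {..<0}"
  shows "tilde_interval \<phi> k f x0 a b = {taylor_quot k f x0 b .. taylor_quot k f x0 a}"
  using eval_interval_closed_interval[OF assms(2,1)] assms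
  by (auto simp: tilde_interval_def)

lemma tilde_interval_encloses:
  assumes "k > 0" "real_analytic f" "formula_for \<phi> ((deriv ^^ Suc k) f)"
    and "interval_defined \<phi> a b" "x0 \<in> {a..b}"
  shows "defines_taylor_enclosure k (tilde_interval \<phi> k f x0 a b) f x0 a b" (is ?encl)
    and "tilde_interval \<phi> k f x0 a b \<subseteq> (\<lambda>z. 1 / fact k * z) ` (deriv ^^ k) f ` {a..b}" (is ?sub)
proof -
  let ?q = "taylor_quot k f x0" and ?T = "tilde_interval \<phi> k f x0 a b"
  let ?R = "(\<lambda>z. 1 / fact k * z) ` (deriv ^^ k) f ` {a..b}"
  note smooth = real_analytic_higher_DERIV[OF assms(2)]
  have ab: "a \<le> b" "a \<in> {a..b}" "b \<in> {a..b}"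
    using assms(5) by auto
  obtain J where J: "eval_interval \<phi> {a..b} = Some J"
    using assms(4) by (auto simp: interval_defined_def)
  have sign: "(deriv ^^ Suc k) f z \<in> J" if "z \<in> {a..b}" for z
    using eval_at_in_eval_interval[OF _ J that] assms(3) by (auto simp: formula_for_def)
  have range: "?q x \<in> ?R" if "x \<in> {a..b}" for x
    using taylor_quot_in_range[OF smooth assms(1) that assms(5)] .
  have ex: "\<exists>l u. l \<le> u \<and> ?R = {l..u}"
  proof -
    have "continuous_on {a..b} (\<lambda>x. 1 / fact k * (deriv ^^ k) f x)"
      by (intro continuous_intros continuous_on_higher_deriv smooth)
    then obtain l u where "(\<lambda>x. 1 / fact k * (deriv ^^ k) f x) ` {a..b} = {l..u}" "l \<le> u"
      using continuous_image_closed_interval[OF ab(1)] by blast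
    then show ?thesis
      by (auto simp: image_image)
  qed
  then obtain l u where R: "l \<le> u" "?R = {l..u}"
    by blast
  obtain l' u' where lu': "l' \<le> u'" "J = {l'..u'}"
    using eval_interval_closed_interval[OF ab(1) J] by blast
  have "(\<exists>l u. l \<le> u \<and> ?T = {l..u}) \<and> ?q ` {a..b} \<subseteq> ?T \<and> ?T \<subseteq> ?R"
  proof -
    consider "0 \<in> J" | "J \<subseteq> {0<..}" | "J \<subseteq> {..<0}"
      using lu' by (cases "l' > 0"; cases "u' < 0") force+
    then show ?thesis
    proof cases
      case 1
      have "?q ` {a..b} \<subseteq> ?R"
        by (rule image_subsetI) (rule range)
      with ex show ?thesis
        unfolding tilde_interval_zero_mem[OF J 1] by (intro conjI order_refl)
    next
      case 2
      have "(deriv ^^ Suc k) f z \<ge> 0" if "z \<in> {a..b}" for z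
        using subsetD[OF 2 sign[OF that]] by simp
      note mono = taylor_quot_mono[OF smooth assms(1,5) _ _ _ this]
      have "?q a \<le> ?q b" "?q ` {a..b} \<subseteq> {?q a..?q b}"
        by (auto simp: ab(1) intro!: mono)
      moreover have "{?q a..?q b} \<subseteq> ?R"
        using range[OF ab(2)] range[OF ab(3)] unfolding R by auto
      ultimately show ?thesis
        unfolding tilde_interval_pos[OF J ab(1) 2] by (intro conjI exI[of _ "?q a"] exI[of _ "?q b"] refl)
    next
      case 3
      have "(deriv ^^ Suc k) f z \<le> 0" if "z \<in> {a..b}" for z
        using subsetD[OF 3 sign[OF that]] by simp
      note antimono = taylor_quot_antimono[OF smooth assms(1,5) _ _ _ this]
      have "?q b \<le> ?q a" "?q ` {a..b} \<subseteq> {?q b..?q a}"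
        by (auto simp: ab(1) intro!: antimono)
      moreover have "{?q b..?q a} \<subseteq> ?R"
        using range[OF ab(2)] range[OF ab(3)] unfolding R by auto
      ultimately show ?thesis
        unfolding tilde_interval_neg[OF J ab(1) 3] by (intro conjI exI[of _ "?q b"] exI[of _ "?q a"] refl)
    qed
  qed
  then show ?encl ?sub
    unfolding defines_taylor_enclosure_def taylor_rem_eq_taylor_quot[OF smooth assms(1)]
    by blast+
qed

lemma eventually_tilde_interval_eq_sharp_interval:
  assumes "k > 0" "real_analytic f" "formula_for \<phi> ((deriv ^^ Suc k) f)"
    and "(deriv ^^ Suc k) f x0 \<noteq> 0"
    and "\<forall>\<^sub>F \<epsilon> in at_right 0. interval_defined \<phi> x0 (x0 + \<epsilon>)"
  shows "\<forall>\<^sub>F \<epsilon> in at_right 0. tilde_interval \<phi> k f x0 x0 (x0 + \<epsilon>) = sharp_interval k f x0 x0 (x0 + \<epsilon>)"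
proof -
  let ?g = "(deriv ^^ Suc k) f"
  note smooth = real_analytic_higher_DERIV[OF assms(2)]
  have shrink: "\<forall>\<^sub>F \<epsilon> in at_right 0. the (eval_interval \<phi> {x0..x0 + \<epsilon>}) \<subseteq> U"
    if "open U" "?g x0 \<in> U" for U
    using assms(3,5) that
    by (intro eventually_eval_interval_subset[OF eventually_Icc_subset_open])
       (auto simp: formula_for_def interval_defined_def)
  have sign: "?g z \<in> J" if "eval_interval \<phi> I = Some J" "z \<in> I" for z I J
    using eval_at_in_eval_interval[OF _ that] assms(3) by (auto simp: formula_for_def)
  show ?thesis
  proof (cases "?g x0 > 0")
    case True
    then have "\<forall>\<^sub>F \<epsilon> in at_right 0. the (eval_interval \<phi> {x0..x0 + \<epsilon>}) \<subseteq> {0<..}"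
      by (intro shrink) auto
    with assms(5) eventually_at_right_less[of "0::real"] show ?thesis
    proof eventually_elim
      case (elim \<epsilon>)
      then obtain J where J: "eval_interval \<phi> {x0..x0 + \<epsilon>} = Some J" "J \<subseteq> {0<..}"
        by (auto simp: interval_defined_def)
      have "?g z \<ge> 0" if "z \<in> {x0..x0 + \<epsilon>}" for z
        using sign[OF J(1) that] J(2) by force
      then show ?case
        using tilde_interval_pos[OF J(1) _ J(2)] sharp_interval_mono[OF smooth assms(1)] elim
        by auto
    qed
  next
    case False
    then have "\<forall>\<^sub>F \<epsilon> in at_right 0. the (eval_interval \<phi> {x0..x0 + \<epsilon>}) \<subseteq> {..<0}"
      using assms(4) by (intro shrink) auto
    with assms(5) eventually_at_right_less[of "0::real"] show ?thesis
    proof eventually_elim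
      case (elim \<epsilon>)
      then obtain J where J: "eval_interval \<phi> {x0..x0 + \<epsilon>} = Some J" "J \<subseteq> {..<0}"
        by (auto simp: interval_defined_def)
      have "?g z \<le> 0" if "z \<in> {x0..x0 + \<epsilon>}" for z
        using sign[OF J(1) that] J(2) by force
      then show ?case
        using tilde_interval_neg[OF J(1) _ J(2)] sharp_interval_antimono[OF smooth assms(1)] elim
        by auto
    qed
  qed
qed

theorem corollary2:
  fixes k :: nat and f :: "real \<Rightarrow> real" and \<phi> :: formula
  assumes "k > 0"
    and "real_analytic f"
    and "formula_for \<phi> ((deriv ^^ (k + 1)) f)"
  shows "(\<forall>a b x0. a \<le> b \<and> interval_defined \<phi> a b \<and> x0 \<in> {a..b} \<longrightarrow>
            defines_taylor_enclosure k (tilde_interval \<phi> k f x0 a b) f x0 a b \<and>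
            tilde_interval \<phi> k f x0 a b \<subseteq> (\<lambda>z. 1 / fact k * z) ` (deriv ^^ k) f ` {a..b})
       \<and> (\<forall>x0. (deriv ^^ (k + 1)) f x0 \<noteq> 0 \<and>
               (\<forall>\<^sub>F \<epsilon> in at_right 0. interval_defined \<phi> x0 (x0 + \<epsilon>)) \<longrightarrow>
            (\<exists>\<delta>>0. \<forall>\<epsilon>\<in>{0<..\<delta>}.
               interval_defined \<phi> x0 (x0 + \<epsilon>) \<and>
               tilde_interval \<phi> k f x0 x0 (x0 + \<epsilon>) = sharp_interval k f x0 x0 (x0 + \<epsilon>)))"
proof -
  have deriv_formula: "formula_for \<phi> ((deriv ^^ Suc k) f)"
    using assms(3) by simp
  show ?thesis
  proof (intro conjI allI impI)
    fix a b x0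
    assume *: "a \<le> b \<and> interval_defined \<phi> a b \<and> x0 \<in> {a..b}"
    show "defines_taylor_enclosure k (tilde_interval \<phi> k f x0 a b) f x0 a b"
      using tilde_interval_encloses(1)[OF assms(1,2) deriv_formula] * by blast
    show "tilde_interval \<phi> k f x0 a b \<subseteq> (\<lambda>z. 1 / fact k * z) ` (deriv ^^ k) f ` {a..b}"
      using tilde_interval_encloses(2)[OF assms(1,2) deriv_formula] * by blast
  next
    fix x0
    assume x0: "(deriv ^^ (k + 1)) f x0 \<noteq> 0 \<and>
                 (\<forall>\<^sub>F \<epsilon> in at_right 0. interval_defined \<phi> x0 (x0 + \<epsilon>))"
    then have "\<forall>\<^sub>F \<epsilon> in at_right 0.
        tilde_interval \<phi> k f x0 x0 (x0 + \<epsilon>) = sharp_interval k f x0 x0 (x0 + \<epsilon>)"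
      using eventually_tilde_interval_eq_sharp_interval[OF assms(1,2) deriv_formula, of x0] by simp
    with x0 have "\<forall>\<^sub>F \<epsilon> in at_right 0. interval_defined \<phi> x0 (x0 + \<epsilon>) \<and>
        tilde_interval \<phi> k f x0 x0 (x0 + \<epsilon>) = sharp_interval k f x0 x0 (x0 + \<epsilon>)"
      by (simp add: eventually_conj_iff)
    then obtain d where "d > 0" "\<And>\<epsilon>. 0 < \<epsilon> \<Longrightarrow> \<epsilon> < d \<Longrightarrow> interval_defined \<phi> x0 (x0 + \<epsilon>) \<and>
        tilde_interval \<phi> k f x0 x0 (x0 + \<epsilon>) = sharp_interval k f x0 x0 (x0 + \<epsilon>)"
      unfolding eventually_at_right_field by blast
    then show "\<exists>\<delta>>0. \<forall>\<epsilon>\<in>{0<..\<delta>}.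
                 interval_defined \<phi> x0 (x0 + \<epsilon>) \<and>
                 tilde_interval \<phi> k f x0 x0 (x0 + \<epsilon>) = sharp_interval k f x0 x0 (x0 + \<epsilon>)"
      \<comment> \<open>The interval for \<open>\<delta>\<close> is closed on the right, the one below \<open>d\<close> is open.\<close>
      by (intro exI[of _ "d / 2"]) auto
  qed
qed

end
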